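(* Let $q=2^s$ ($s\ge 1$), let $k\ge 1$ be an integer, $e=3k$, and $g=x^2+S_{4k}S_{2k}\in\mathbb{F}_2[x]$. Then $g$ is a permutation polynomial of $\mathbb{F}_{q^e}$.
   Context: For an integer $a\ge 0$, $S_a=x+x^q+\cdots+x^{q^{a-1}}$. A permutation polynomial of a finite field $\mathbb{F}$ is a polynomial inducing a bijection of $\mathbb{F}$. *)

theory Defs
  imports
    "HOL-Computational_Algebra.Computational_Algebra"
    "HOL-Library.Z2"
    "HOL-Library.Cardinality"
begin

definition S :: "nat \<Rightarrow> nat \<Rightarrow> 'a::comm_ring_1 poly" where
  "S q a = (\<Sum>i<a. monom 1 (q ^ i))"

text \<open>The field with two elements is the type \<^typ>\<open>bit\<close>. The map below is the inclusion of the
  prime field; it is a ring homomorphism exactly when the target has characteristic 2.\<close>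

definition bit_embed :: "bit \<Rightarrow> 'a::comm_ring_1" where
  "bit_embed b = of_bool (b = 1)"

lemma bit_embed_0 [simp]: "bit_embed 0 = 0"
  and bit_embed_1 [simp]: "bit_embed 1 = 1"
  by (simp_all add: bit_embed_def)

lemma bit_embed_mult: "bit_embed (a * b) = bit_embed a * bit_embed b"
  by (cases a; cases b) simp_all

lemma bit_embed_add:
  assumes "(2 :: 'a::comm_ring_1) = 0"
  shows "(bit_embed (a + b) :: 'a) = bit_embed a + bit_embed b"
  using assms by (cases a; cases b) simp_all

definition permutation_polynomial :: "'a::{field,finite} poly \<Rightarrow> bool" where
  "permutation_polynomial f \<longleftrightarrow> bij (poly f)"

end

theory Submission
  imports Defs
begin

text \<open>Put \<open>Q = q ^ k\<close> and \<open>w = S\<^bsub>4k\<^esub>(x)\<close>. In the field with \<open>Q ^ 3\<close> elements, writing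
  \<open>y = S\<^sub>k(x)\<close>, one has \<open>w = y\<^sup>Q + y\<^bsup>Q*Q\<^esup>\<close> and \<open>S\<^bsub>2k\<^esub>(x) = y + y\<^sup>Q = w\<^bsup>Q*Q\<^esup>\<close>. The relations
  \<open>x + x\<^sup>Q = y + y\<^sup>q\<close> and \<open>Tr(x)\<^sup>q = Tr(x)\<close> give \<open>g(x) + g(x)\<^sup>Q = w\<^bsup>2q\<^esup>\<close>. Hence \<open>g(x)\<close> determines
  \<open>w\<close>, and then also \<open>x\<^sup>2 = g(x) - w * w\<^bsup>Q*Q\<^esup>\<close>, so that the injectivity of the
  Frobenius map recovers \<open>x\<close>.\<close>

text \<open>Multiplication by a nonzero \<open>x\<close> permutes the nonzero elements, so comparing
  their products before and after cancels to \<open>x ^ (CARD('a) - 1) = 1\<close>.\<close>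

lemma field_power_CARD_eq_same:
  fixes x :: "'a::{field,finite}"
  shows "x ^ CARD('a) = x"
proof (cases "x = 0")
  case False
  let ?U = "UNIV - {0::'a}"
  have "x ^ card ?U * \<Prod>?U = (\<Prod>y\<in>?U. x * y)"
    by (simp add: prod.distrib)
  also have "\<dots> = \<Prod>?U"
    by (rule prod.reindex_bij_witness[of _ "\<lambda>y. y / x" "\<lambda>y. x * y"]) (use False in auto)
  finally have "x ^ card ?U = 1"
    by simp
  moreover have "CARD('a) = Suc (card ?U)"
    by (rule card.remove) auto
  ultimately show ?thesis
    by (simp only: power_Suc mult_1_right)
qed simp

text \<open>Translation by 1 permutes the ring, so the sum of all elements does not change when 1 is
  added to each of them.\<close>

lemma of_nat_CARD_eq_0: "of_nat CARD('a) = (0 :: 'a::{ring_1,finite})"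
proof -
  have "(\<Sum>y\<in>UNIV. y + 1) = (\<Sum>y\<in>UNIV. y :: 'a)"
    by (rule sum.reindex_bij_witness[of _ "\<lambda>y. y - 1" "\<lambda>y. y + 1"]) auto
  then show ?thesis
    by (simp add: sum.distrib)
qed

lemma CHAR_eq_prime_of_CARD:
  assumes "prime p" and "CARD('a::{field,finite}) = p ^ n"
  shows "CHAR('a) = p"
proof -
  have "CHAR('a) > 0"
    by (rule finite_imp_CHAR_pos) simp
  then have "prime CHAR('a)"
    by (rule prime_CHAR_semidom)
  moreover have "CHAR('a) dvd p ^ n"
    using of_nat_CARD_eq_0[where ?'a = 'a] assms(2)
    by (simp add: of_nat_eq_0_iff_char_dvd del: of_nat_power)
  ultimately show ?thesis
    using assms(1) prime_dvd_power primes_dvd_imp_eq by blast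
qed

text \<open>Iterated Frobenius is additive, and its kernel is trivial in a domain.\<close>

lemma inj_power_CHAR_power:
  assumes "prime CHAR('a::idom)"
  shows "inj (\<lambda>x::'a. x ^ (CHAR('a) ^ n))"
proof (rule injI)
  fix x y :: 'a
  assume "x ^ (CHAR('a) ^ n) = y ^ (CHAR('a) ^ n)"
  moreover have "((x - y) + y) ^ (CHAR('a) ^ n) = (x - y) ^ (CHAR('a) ^ n) + y ^ (CHAR('a) ^ n)"
    by (rule freshmans_dream') (use assms in auto)
  ultimately show "x = y"
    by simp
qed

lemma map_poly_bit_embed_add:
  assumes "(2 :: 'a::comm_ring_1) = 0"
  shows "(map_poly bit_embed (f + g) :: 'a poly) = map_poly bit_embed f + map_poly bit_embed g"
  by (rule poly_eqI)
    (simp only: coeff_map_poly bit_embed_0 coeff_add bit_embed_add[OF assms])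

lemma bit_embed_sum:
  assumes "(2 :: 'a::comm_ring_1) = 0"
  shows "(bit_embed (\<Sum>i\<in>I. f i) :: 'a) = (\<Sum>i\<in>I. bit_embed (f i))"
  by (induction I rule: infinite_finite_induct)
    (simp_all only: sum.infinite sum.empty sum.insert bit_embed_0 bit_embed_add[OF assms] not_False_eq_True)

lemma map_poly_bit_embed_mult:
  assumes "(2 :: 'a::comm_ring_1) = 0"
  shows "(map_poly bit_embed (f * g) :: 'a poly) = map_poly bit_embed f * map_poly bit_embed g"
  by (rule poly_eqI)
    (simp only: coeff_map_poly bit_embed_0 coeff_mult bit_embed_sum[OF assms] bit_embed_mult)

lemma map_poly_bit_embed_S:
  assumes "(2 :: 'a::comm_ring_1) = 0"
  shows "(map_poly bit_embed (S q n) :: 'a poly) = S q n"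
  by (induction n) (simp_all add: S_def map_poly_bit_embed_add[OF assms] map_poly_monom)

lemma poly_S_1: "poly (S q (Suc 0)) x = x"
  by (simp add: S_def poly_monom)

text \<open>The terms of index \<open>m\<close> to \<open>m + n - 1\<close> are the first
  \<open>n\<close> terms raised to the power \<open>q ^ m\<close>, which is an iterate of Frobenius
  and so commutes with the sum.\<close>

lemma poly_S_add:
  fixes x :: "'a::comm_ring_1"
  assumes "prime CHAR('a)" and "q = CHAR('a) ^ s"
  shows "poly (S q (m + n)) x = poly (S q m) x + poly (S q n) x ^ (q ^ m)"
proof (induction n)
  case (Suc n)
  have "(u + v) ^ (q ^ m) = u ^ (q ^ m) + v ^ (q ^ m)" for u v :: 'a
    by (rule freshmans_dream'[of _ "s * m"]) (simp_all add: assms power_mult)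
  with Suc show ?case
    by (simp add: S_def poly_monom add.assoc power_add mult.commute flip: power_mult)
next
  case 0
  \<comment> \<open>A positive exponent is needed for \<open>0 ^ (q ^ m) = 0\<close>, the
    contribution of the empty sum.\<close>
  have "q ^ m \<noteq> 0"
    using assms(1) by (auto simp: assms(2))
  then show ?case
    by (simp add: S_def power_0_left)
qed

theorem theorem6p15:
  fixes q s k e :: nat and g :: "bit poly"
  assumes "s \<ge> 1" and "q = 2 ^ s" and "k \<ge> 1" and "e = 3 * k"
    and "g = monom 1 2 + S q (4 * k) * S q (2 * k)"
    and "CARD('a::{field,finite}) = q ^ e"
  shows "permutation_polynomial (map_poly bit_embed g :: 'a poly)"
proof -
  define Q where "Q = q ^ k"
  define G :: "'a \<Rightarrow> 'a" where "G = poly (map_poly bit_embed g)"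
  define w :: "'a \<Rightarrow> 'a" where "w = poly (S q (4 * k))"
  have CHAR: "CHAR('a) = 2"
    by (rule CHAR_eq_prime_of_CARD[of _ "s * e"]) (use assms in \<open>simp_all add: power_mult\<close>)
  have two: "(2 :: 'a) = 0"
    using of_nat_CHAR[where ?'a = 'a] CHAR by simp
  have add_self: "u + u = 0" for u :: 'a
    by (metis mult_2 mult_zero_left two)
  have add_self_left: "u + (u + v) = v" for u v :: 'a
    by (metis add.assoc add.left_neutral add_self)
  have frob_add: "(u + v) ^ (2 ^ n) = u ^ (2 ^ n) + v ^ (2 ^ n)" for u v :: 'a and n
    by (rule freshmans_dream') (simp_all add: CHAR)
  have frob_inj: "u = v" if "u ^ (2 ^ n) = v ^ (2 ^ n)" for u v :: 'a and n
    using inj_power_CHAR_power[where ?'a = 'a, of n] that by (simp add: CHAR inj_def)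
  have sq_add: "(u + v)\<^sup>2 = u\<^sup>2 + v\<^sup>2" for u v :: 'a
    using frob_add[of u v 1] by simp
  have q_add: "(u + v) ^ q = u ^ q + v ^ q" for u v :: 'a
    unfolding \<open>q = 2 ^ s\<close> by (rule frob_add)
  have Q_add: "(u + v) ^ Q = u ^ Q + v ^ Q" for u v :: 'a
    unfolding Q_def \<open>q = 2 ^ s\<close> power_mult[symmetric] by (rule frob_add)
  have power_qe: "u ^ (q ^ (3 * k)) = u" for u :: 'a
    using field_power_CARD_eq_same[of u] assms by simp
  have Q3: "((u ^ Q) ^ Q) ^ Q = u" for u :: 'a
    using power_qe[of u]
    by (simp add: Q_def numeral_3_eq_3 mult.assoc add.assoc flip: power_mult power_add)
  have S_add: "poly (S q (m + n)) x = poly (S q m) x + poly (S q n) x ^ (q ^ m)" for m n and x :: 'a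
    by (rule poly_S_add) (simp_all add: CHAR \<open>q = 2 ^ s\<close>)
  \<comment> \<open>Split the sum of \<open>n + 1\<close> terms in two ways: after its first term
    and before its last.\<close>
  have S_q: "x + poly (S q n) x ^ q = poly (S q n) x + x ^ (q ^ n)" for n and x :: 'a
    using S_add[of 1 n x] S_add[of n 1 x] by (simp add: poly_S_1 add.commute)

  have key: "G x = x\<^sup>2 + w x * ((w x) ^ Q) ^ Q \<and> G x + G x ^ Q = (w x ^ q)\<^sup>2" for x
  proof -
    \<comment> \<open>These three conjugates are permuted cyclically by the \<open>Q\<close>-th
      power.\<close>
    define y p r where "y = poly (S q k) x" and "p = y ^ Q" and "r = p ^ Q"
    have r_Q: "r ^ Q = y"
      by (simp add: r_def p_def Q3)
    have S2: "poly (S q (2 * k)) x = y + p"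
      using S_add[of k k x] by (simp add: y_def p_def Q_def mult_2)
    have S3: "poly (S q (3 * k)) x = y + (p + r)"
      using S_add[of k "2 * k" x] S2 by (simp add: Q_add flip: Q_def y_def p_def r_def)
    \<comment> \<open>The last block of \<open>k\<close> terms is \<open>y ^ (Q ^ 3) = y\<close>,
      which cancels the first block.\<close>
    have w: "w x = p + r"
      using S_add[of "3 * k" k x] S3 power_qe[of y]
      by (simp add: w_def add.commute add_self_left flip: y_def)
    have G: "G x = x\<^sup>2 + (p + r) * (y + p)"
      using w S2 unfolding G_def w_def assms(5)
      by (simp add: map_poly_bit_embed_add map_poly_bit_embed_mult map_poly_bit_embed_S two
          map_poly_monom poly_monom)
    have w_QQ: "((w x) ^ Q) ^ Q = y + p"
      by (simp add: w Q_add r_Q flip: p_def r_def)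
    have "w x = poly (S q (3 * k)) x + y"
      by (simp add: w S3 add.commute add_self_left)
    \<comment> \<open>This is the trace to the subfield of order \<open>q\<close>: in
      \<open>S_q\<close> with \<open>n = 3 * k\<close> the two outer terms are both
      \<open>x\<close>.\<close>
    moreover have "poly (S q (3 * k)) x ^ q = poly (S q (3 * k)) x"
      using S_q[of x "3 * k"] power_qe[of x] by (simp add: add.commute)
    ultimately have w_q: "w x ^ q = (y + (p + r)) + y ^ q"
      by (simp only: q_add S3)
    have "x + y ^ q = y + x ^ Q"
      using S_q[of x k] by (simp add: y_def Q_def)
    then have x_Q: "x + x ^ Q = y + y ^ q"
      by (metis add.commute add.left_commute add_self_left)
    have "G x ^ Q = (x ^ Q)\<^sup>2 + (r + y) * (p + r)"
      by (simp add: G Q_add r_Q power_mult_distrib power2_eq_square flip: p_def r_def)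
    then have "G x + G x ^ Q = (x + x ^ Q)\<^sup>2 + (p + r) * ((y + p) + (r + y))"
      by (simp add: G sq_add algebra_simps)
    also have "(y + p) + (r + y) = p + r"
      by (metis add.commute add.left_commute add_self_left)
    \<comment> \<open>Both sides are the square of \<open>y + y ^ q + p + r\<close>.\<close>
    also have "(x + x ^ Q)\<^sup>2 + (p + r) * (p + r) = (w x ^ q)\<^sup>2"
      by (simp only: x_Q w_q power2_eq_square[symmetric] sq_add) (simp only: ac_simps)
    finally show ?thesis
      using G w w_QQ by simp
  qed

  have "inj G"
  proof (rule injI)
    fix a b assume eq: "G a = G b"
    then have "(w a ^ q)\<^sup>2 = (w b ^ q)\<^sup>2"
      using key by metis
    \<comment> \<open>The \<open>q\<close>-th power followed by squaring is a single iterate of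
      Frobenius.\<close>
    then have "w a ^ (2 ^ (s + 1)) = w b ^ (2 ^ (s + 1))"
      by (simp add: \<open>q = 2 ^ s\<close> mult.commute flip: power_mult)
    then have "w a = w b"
      by (rule frob_inj)
    \<comment> \<open>With \<open>w a = w b\<close>, the products in the formula for
      \<open>G\<close> agree, leaving equal squares; \<open>2 ^ 1\<close> fits
      \<open>frob_inj\<close>.\<close>
    then have "a ^ (2 ^ 1) = b ^ (2 ^ 1)"
      using key[of a] key[of b] eq by simp
    then show "a = b"
      by (rule frob_inj)
  qed
  then show ?thesis
    unfolding permutation_polynomial_def bij_def G_def by (simp add: finite_UNIV_inj_surj)
qed

end
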